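(* The generating functions of the Padovan hyperbolic spinors $\psi_n$ and of the Perrin hyperbolic spinors $\phi_n$ are, as formal power series in $x$, $$\sum_{n=0}^\infty \psi_n x^n=\frac{1}{1-x^2-x^3}\begin{bmatrix}1+x+(2+2x+x^2)j\\ -1-x-x^2+(1+2x+x^2)j\end{bmatrix},$$ $$\sum_{n=0}^\infty \phi_n x^n=\frac{1}{1-x^2-x^3}\begin{bmatrix}3-x^2+(3+2x+2x^2)j\\ -2x-3x^2+(2+3x)j\end{bmatrix}.$$
   Context: Hyperbolic numbers are expressions $a+bj$ with $a,b\in\mathbb{R}$ and a unit $j\notin\mathbb{R}$, $j^2=1$; they form a commutative ring. A hyperbolic spinor is a column vector with two hyperbolic number components, with componentwise addition and scalar multiplication. The Padovan numbers $(P_n)_{n\ge 0}$ are defined by $P_0=P_1=P_2=1$ and $P_{n+3}=P_{n+1}+P_n$ for $n\ge0$. The Perrin numbers $(R_n)_{n\ge 0}$ are defined by $R_0=3$, $R_1=0$, $R_2=2$ and $R_{n+3}=R_{n+1}+R_n$ for $n\ge 0$. The $n$-th Padovan hyperbolic spinor and the $n$-th Perrin hyperbolic spinor are $$\psi_n=\begin{bmatrix}P_n+P_{n+3}j\\ -P_{n+1}+P_{n+2}j\end{bmatrix},\qquad \phi_n=\begin{bmatrix}R_n+R_{n+3}j\\ -R_{n+1}+R_{n+2}j\end{bmatrix}.$$ *)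

theory Defs
  imports "HOL-Analysis.Analysis" "HOL-Computational_Algebra.Formal_Power_Series"
begin

unbundle no fps_syntax

datatype hyperbolic = Hyp (hre: real) (him: real)

instantiation hyperbolic :: comm_ring_1
begin

definition "0 = Hyp 0 0"
definition "1 = Hyp 1 0"
definition "x + y = Hyp (hre x + hre y) (him x + him y)"
definition "- x = Hyp (- hre x) (- him x)"
definition "x - y = Hyp (hre x - hre y) (him x - him y)"
definition "x * y = Hyp (hre x * hre y + him x * him y) (hre x * him y + him x * hre y)"

instance
  by standard
    (simp_all add: zero_hyperbolic_def one_hyperbolic_def plus_hyperbolic_def
      uminus_hyperbolic_def minus_hyperbolic_def times_hyperbolic_def algebra_simps)

end

instantiation hyperbolic :: real_algebra_1
begin

definition "r *\<^sub>R x = Hyp (r * hre x) (r * him x)"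

instance
  by standard
    (simp_all add: scaleR_hyperbolic_def zero_hyperbolic_def one_hyperbolic_def
      plus_hyperbolic_def times_hyperbolic_def algebra_simps)

end

(* The reciprocal is (a - b j) / (a^2 - b^2). On zero divisors, where a^2 = b^2, it is 0
   because division by zero is 0 in the reals. *)
instantiation hyperbolic :: inverse
begin

definition "inverse x = Hyp (hre x / ((hre x)\<^sup>2 - (him x)\<^sup>2)) (- him x / ((hre x)\<^sup>2 - (him x)\<^sup>2))"
definition "x div y = x * inverse (y :: hyperbolic)"

instance ..

end

definition hyp_j :: hyperbolic ("\<j>")
  where "\<j> = Hyp 0 1"

lemma hyp_j_square: "\<j> ^ 2 = 1"
  by (simp add: hyp_j_def one_hyperbolic_def times_hyperbolic_def power2_eq_square)

lemma Hyp_eq: "Hyp a b = of_real a + of_real b * \<j>"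
  by (simp add: hyp_j_def of_real_def scaleR_hyperbolic_def one_hyperbolic_def
      plus_hyperbolic_def times_hyperbolic_def)

lemma hyp_j_not_real: "\<j> \<notin> \<real>"
  by (auto simp: Reals_def of_real_def hyp_j_def scaleR_hyperbolic_def one_hyperbolic_def)

type_synonym spinor = "hyperbolic ^ 2"

fun padovan :: "nat \<Rightarrow> nat"
  where
    "padovan 0 = 1"
  | "padovan (Suc 0) = 1"
  | "padovan (Suc (Suc 0)) = 1"
  | "padovan (Suc (Suc (Suc n))) = padovan (Suc n) + padovan n"

fun perrin :: "nat \<Rightarrow> nat"
  where
    "perrin 0 = 3"
  | "perrin (Suc 0) = 0"
  | "perrin (Suc (Suc 0)) = 2"
  | "perrin (Suc (Suc (Suc n))) = perrin (Suc n) + perrin n"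

definition padovan_spinor :: "nat \<Rightarrow> spinor"
  where "padovan_spinor n = vector
    [of_nat (padovan n) + of_nat (padovan (n + 3)) * \<j>,
     - of_nat (padovan (n + 1)) + of_nat (padovan (n + 2)) * \<j>]"

definition perrin_spinor :: "nat \<Rightarrow> spinor"
  where "perrin_spinor n = vector
    [of_nat (perrin n) + of_nat (perrin (n + 3)) * \<j>,
     - of_nat (perrin (n + 1)) + of_nat (perrin (n + 2)) * \<j>]"

(* The formal power series with spinor coefficients \<psi> 0, \<psi> 1, ..., written as a column of
   formal power series over the hyperbolic numbers. In this form a hyperbolic power series
   acts on it by the usual scalar multiplication *s. *)
definition spinor_gf :: "(nat \<Rightarrow> spinor) \<Rightarrow> hyperbolic fps ^ 2"
  where "spinor_gf \<psi> = (\<chi> i. Abs_fps (\<lambda>n. \<psi> n $ i))"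

(* The termwise sum of \<psi> n x^n converges to spinor_gf \<psi> in the formal topology. *)
lemma spinor_gf_sums:
  "(\<lambda>n. fps_X ^ n *s (\<chi> i. fps_const (\<psi> n $ i))) sums spinor_gf \<psi>"
  unfolding sums_def
proof (rule vec_tendstoI)
  fix i
  have "(\<lambda>N. \<Sum>n<N. fps_const (\<psi> n $ i) * fps_X ^ n) \<longlonglongrightarrow> Abs_fps (\<lambda>n. \<psi> n $ i)"
    by (subst LIMSEQ_lessThan_iff_atMost)
      (use fps_notation[of "Abs_fps (\<lambda>n. \<psi> n $ i)"] in \<open>simp add: atLeast0AtMost\<close>)
  then show "(\<lambda>N. (\<Sum>n<N. fps_X ^ n *s (\<chi> i. fps_const (\<psi> n $ i))) $ i) \<longlonglongrightarrow> spinor_gf \<psi> $ i"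
    by (simp add: spinor_gf_def mult.commute)
qed

(* The denominator 1 - x^2 - x^3 is a unit, so dividing by it is a genuine division. *)
lemma denominator_inverse:
  "(1 - fps_X ^ 2 - fps_X ^ 3 :: hyperbolic fps) * (1 / (1 - fps_X ^ 2 - fps_X ^ 3)) = 1"
proof -
  let ?d = "1 - fps_X ^ 2 - fps_X ^ 3 :: hyperbolic fps"
  have d0: "fps_nth ?d 0 = 1"
    by simp
  have inv1: "inverse (1 :: hyperbolic) = 1"
    by (simp add: inverse_hyperbolic_def one_hyperbolic_def)
  have "?d * inverse ?d = 1"
    unfolding fps_inverse_def by (rule fps_right_inverse) (simp add: d0 inv1)
  moreover have "1 / ?d = inverse ?d"
    by (subst fps_divide_unit) (use d0 in auto)
  ultimately show ?thesis
    by simp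
qed

end

theory Submission
  imports Defs
begin

text \<open>Each component of either spinor sequence is a fixed linear combination of shifts of one
  integer sequence, so it inherits the recurrence a(n+3) = a(n+1) + a(n). Multiplying its generating
  function by 1 - x^2 - x^3 therefore kills every coefficient from degree 3 on and leaves a
  quadratic numerator fixed by a(0), a(1), a(2) (\<open>fps_recurrence_mult_denominator\<close>).
  Dividing by the unit 1 - x^2 - x^3 and inserting the initial values gives the four
  components.\<close>

lemma fps_recurrence_mult_denominator:
  fixes a :: "nat \<Rightarrow> 'a :: comm_ring_1"
  assumes rec: "\<And>n. a (n + 3) = a (n + 1) + a n"
  shows "(1 - fps_X ^ 2 - fps_X ^ 3) * Abs_fps a =
    fps_const (a 0) + fps_const (a 1) * fps_X + fps_const (a 2 - a 0) * fps_X ^ 2"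
proof (rule fps_ext)
  fix n :: nat
  \<comment> \<open>Below degree 3 some of the shifts by x^2 and x^3 contribute nothing. In degree m
    + 3 the coefficient is a(m+3) - a(m+1) - a(m) = 0.\<close>
  consider "n = 0" | "n = 1" | "n = 2" | m where "n = m + 3"
    using le_Suc_ex[of 3 n] by (cases "n < 3") (auto simp: less_Suc_eq numeral_3_eq_3 numeral_2_eq_2 add.commute)
  then show "fps_nth ((1 - fps_X ^ 2 - fps_X ^ 3) * Abs_fps a) n = fps_nth
    (fps_const (a 0) + fps_const (a 1) * fps_X + fps_const (a 2 - a 0) * fps_X ^ 2) n"
    by cases (simp_all add: left_diff_distrib fps_X_power_mult_nth rec)
qed

text \<open>The hyperbolic numbers have zero divisors, so the denominator is cancelled through its
  explicit inverse from \<open>denominator_inverse\<close>. The numerator \<open>p\<close> is left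
  free so that it can be matched with any written form.\<close>

lemma generating_function_eq:
  fixes a :: "nat \<Rightarrow> hyperbolic"
  assumes "\<And>n. a (n + 3) = a (n + 1) + a n"
    and "fps_const (a 0) + fps_const (a 1) * fps_X + fps_const (a 2 - a 0) * fps_X ^ 2 = p"
  shows "Abs_fps a = 1 / (1 - fps_X ^ 2 - fps_X ^ 3) * p"
proof -
  let ?d = "1 - fps_X ^ 2 - fps_X ^ 3 :: hyperbolic fps"
  have "1 / ?d * p = 1 / ?d * (?d * Abs_fps a)"
    using fps_recurrence_mult_denominator[of a] assms by simp
  also have "\<dots> = Abs_fps a"
    using denominator_inverse by (simp only: mult.assoc[symmetric] mult.commute[of "1 / ?d"] mult_1_left)
  finally show ?thesis ..
qed

lemma padovan_recurrence: "padovan (n + 3) = padovan (n + 1) + padovan n"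
  by (simp add: numeral_3_eq_3)

lemma perrin_recurrence: "perrin (n + 3) = perrin (n + 1) + perrin n"
  by (simp add: numeral_3_eq_3)

text \<open>The numerators involve the spinors with n = 0, 1, 2, whose entries reach index n + 3,
  hence at most 5.\<close>

lemma padovan_initial: "padovan 2 = 1" "padovan 3 = 2" "padovan 4 = 2" "padovan 5 = 3"
  by (simp_all add: eval_nat_numeral)

lemma perrin_initial: "perrin 2 = 2" "perrin 3 = 3" "perrin 4 = 2" "perrin 5 = 5"
  by (simp_all add: eval_nat_numeral)

lemma padovan_spinor_recurrence:
  "padovan_spinor (n + 3) $ i = padovan_spinor (n + 1) $ i + padovan_spinor n $ i"
  using exhaust_2[of i] padovan_recurrence[of n] padovan_recurrence[of "n + 1"]
    padovan_recurrence[of "n + 2"] padovan_recurrence[of "n + 3"]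
  by (auto simp: padovan_spinor_def add.assoc distrib_right)

lemma perrin_spinor_recurrence:
  "perrin_spinor (n + 3) $ i = perrin_spinor (n + 1) $ i + perrin_spinor n $ i"
  using exhaust_2[of i] perrin_recurrence[of n] perrin_recurrence[of "n + 1"]
    perrin_recurrence[of "n + 2"] perrin_recurrence[of "n + 3"]
  by (auto simp: perrin_spinor_def add.assoc distrib_right)

theorem theorem13:
  shows "spinor_gf padovan_spinor =
      (1 / (1 - fps_X ^ 2 - fps_X ^ 3)) *s
        vector [1 + fps_X + (2 + 2 * fps_X + fps_X ^ 2) * fps_const \<j>,
                - 1 - fps_X - fps_X ^ 2 + (1 + 2 * fps_X + fps_X ^ 2) * fps_const \<j>]
    \<and> spinor_gf perrin_spinor =
      (1 / (1 - fps_X ^ 2 - fps_X ^ 3)) *s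
        vector [3 - fps_X ^ 2 + (3 + 2 * fps_X + 2 * fps_X ^ 2) * fps_const \<j>,
                - 2 * fps_X - 3 * fps_X ^ 2 + (2 + 3 * fps_X) * fps_const \<j>]"
  unfolding vec_eq_iff forall_2 spinor_gf_def vector_smult_component vec_lambda_beta vector_2
proof (intro conjI)
  note eval = padovan_spinor_def perrin_spinor_def padovan_initial perrin_initial
  show "Abs_fps (\<lambda>n. padovan_spinor n $ 1) = 1 / (1 - fps_X ^ 2 - fps_X ^ 3) *
      (1 + fps_X + (2 + 2 * fps_X + fps_X ^ 2) * fps_const \<j>)"
    \<comment> \<open>Only the identity of the numerators remains. Here a(0) = a(1) = 1 + 2j and
      a(2) - a(0) = j; the other three components are compared in the same way.\<close>
    by (rule generating_function_eq[OF padovan_spinor_recurrence])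
      (rule fps_ext, simp add: eval numeral_fps_const fps_X_power_mult_right_nth
        fps_X_power_mult_nth algebra_simps)
  show "Abs_fps (\<lambda>n. padovan_spinor n $ 2) = 1 / (1 - fps_X ^ 2 - fps_X ^ 3) *
      (- 1 - fps_X - fps_X ^ 2 + (1 + 2 * fps_X + fps_X ^ 2) * fps_const \<j>)"
    by (rule generating_function_eq[OF padovan_spinor_recurrence])
      (rule fps_ext, simp add: eval numeral_fps_const fps_X_power_mult_right_nth
        fps_X_power_mult_nth algebra_simps)
  show "Abs_fps (\<lambda>n. perrin_spinor n $ 1) = 1 / (1 - fps_X ^ 2 - fps_X ^ 3) *
      (3 - fps_X ^ 2 + (3 + 2 * fps_X + 2 * fps_X ^ 2) * fps_const \<j>)"
    by (rule generating_function_eq[OF perrin_spinor_recurrence])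
      (rule fps_ext, simp add: eval numeral_fps_const fps_X_power_mult_right_nth
        fps_X_power_mult_nth algebra_simps)
  show "Abs_fps (\<lambda>n. perrin_spinor n $ 2) = 1 / (1 - fps_X ^ 2 - fps_X ^ 3) *
      (- 2 * fps_X - 3 * fps_X ^ 2 + (2 + 3 * fps_X) * fps_const \<j>)"
    by (rule generating_function_eq[OF perrin_spinor_recurrence])
      (rule fps_ext, simp add: eval numeral_fps_const fps_X_power_mult_right_nth
        fps_X_power_mult_nth algebra_simps)
qed

end
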